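(* Let $B$ be a nonnegative integer-valued random variable with $b:=\mathbb E B\in(0,1)$ and $\mathbb P(B>x)=L(x)/(1+x)$, where $L$ is slowly varying and $L(x)\sim(\log x)^{-1-\varepsilon}$ as $x\to\infty$ for some $\varepsilon>0$. Define the laws of $D_n$, $n\ge1$, recursively by $D_1\stackrel{d}{=}B$ and $$D_{n+1}\stackrel{d}{=}\sum_{i=1}^{B}D_{n,i}\qquad(n\ge1),$$ where $\{D_{n,i}\}_{i\ge1}$ are i.i.d. copies of $D_n$ independent of $B$. Then for each fixed $n\in\mathbb N$, $n\ge1$, as $x\to\infty$, $$\mathbb P(D_n>x)\ \sim\ n\,b^{\,n-1}\,\mathbb P(B>x).$$
   Context: $\stackrel{d}{=}$ denotes equality in distribution; $f(x)\sim g(x)$ means $f(x)/g(x)\to1$ as $x\to\infty$. A measurable $L:(0,\infty)\to(0,\infty)$ is slowly varying if $L(tx)/L(x)\to1$ as $x\to\infty$ for each $t>0$. *)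

theory Defs
  imports "HOL-Probability.Probability" "HOL-Library.Landau_Symbols"
begin

definition slowly_varying :: "(real \<Rightarrow> real) \<Rightarrow> bool" where
  "slowly_varying L \<longleftrightarrow>
     (\<forall>x>0. L x > 0) \<and>
     L \<in> borel_measurable (restrict_space borel {0<..}) \<and>
     (\<forall>t>0. ((\<lambda>x. L (t * x) / L x) \<longlongrightarrow> 1) at_top)"

(* The law of X 1 + ... + X N, where N has law mu, the X i are i.i.d. with law nu and
   independent of N, realised on the canonical product space; see distr_random_sum.
   The summands are indexed from 0. *)
definition random_sum_law :: "nat measure \<Rightarrow> nat measure \<Rightarrow> nat measure" where
  "random_sum_law \<mu> \<nu> =
     distr (\<mu> \<Otimes>\<^sub>M (\<Pi>\<^sub>M i\<in>(UNIV :: nat set). \<nu>)) (count_space UNIV) (\<lambda>(k, d). \<Sum>i<k. d i)"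

lemma measurable_random_sum:
  "(\<lambda>(k, d). \<Sum>i<k. d i) \<in>
     measurable (count_space UNIV \<Otimes>\<^sub>M (\<Pi>\<^sub>M i\<in>(UNIV :: nat set). count_space UNIV))
       (count_space (UNIV :: nat set))"
proof -
  have "(\<lambda>d. \<Sum>i<k. d i) \<in> measurable (\<Pi>\<^sub>M i\<in>(UNIV :: nat set). count_space (UNIV :: nat set))
          (count_space UNIV)" for k :: nat
  proof (induction k)
    case (Suc k)
    note [measurable] = this
    show ?case by simp
  qed simp
  then show ?thesis
    by (intro measurable_pair_measure_countable1) auto
qed

lemma distr_random_sum:
  fixes N :: "'a \<Rightarrow> nat" and X :: "nat \<Rightarrow> 'a \<Rightarrow> nat"
  assumes "prob_space M"
    and N: "N \<in> measurable M (count_space UNIV)"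
    and X: "\<And>i. X i \<in> measurable M (count_space UNIV)"
    and \<nu>: "\<And>i. distr M (count_space UNIV) (X i) = \<nu>"
    and iid: "prob_space.indep_vars M (\<lambda>_. count_space UNIV) X UNIV"
    and ind: "prob_space.indep_set M
                (sets (vimage_algebra (space M) N (count_space UNIV)))
                (sets (vimage_algebra (space M) (\<lambda>\<omega> i. X i \<omega>) (\<Pi>\<^sub>M i\<in>UNIV. count_space UNIV)))"
  shows "distr M (count_space UNIV) (\<lambda>\<omega>. \<Sum>i<N \<omega>. X i \<omega>) =
         random_sum_law (distr M (count_space UNIV) N) \<nu>"
proof -
  interpret prob_space M by fact
  let ?C = "count_space UNIV :: nat measure"
  let ?P = "\<Pi>\<^sub>M i\<in>(UNIV :: nat set). ?C"
  let ?S = "\<lambda>(k, d). \<Sum>i<k. d i :: nat"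
  have XX: "(\<lambda>\<omega> i. X i \<omega>) \<in> measurable M ?P"
    using X by (intro measurable_PiM_single') auto
  have "distr M ?P (\<lambda>\<omega> i. X i \<omega>) = (\<Pi>\<^sub>M i\<in>UNIV. distr M ?C (X i))"
    using indep_vars_iff_distr_eq_PiM'[of UNIV X "\<lambda>_. ?C"] X iid by (simp add: restrict_def)
  also have "\<dots> = (\<Pi>\<^sub>M i\<in>UNIV. \<nu>)" by (simp add: \<nu>)
  finally have 1: "distr M ?P (\<lambda>\<omega> i. X i \<omega>) = (\<Pi>\<^sub>M i\<in>UNIV. \<nu>)" .
  have 2: "distr M ?C N \<Otimes>\<^sub>M distr M ?P (\<lambda>\<omega> i. X i \<omega>) =
           distr M (?C \<Otimes>\<^sub>M ?P) (\<lambda>\<omega>. (N \<omega>, \<lambda>i. X i \<omega>))"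
  proof (rule pair_measure_eqI)
    interpret N: prob_space "distr M ?C N" using N by (rule prob_space_distr)
    interpret XD: prob_space "distr M ?P (\<lambda>\<omega> i. X i \<omega>)" using XX by (rule prob_space_distr)
    show "sigma_finite_measure (distr M ?C N)" ..
    show "sigma_finite_measure (distr M ?P (\<lambda>\<omega> i. X i \<omega>))" ..
    show "sets (distr M ?C N \<Otimes>\<^sub>M distr M ?P (\<lambda>\<omega> i. X i \<omega>)) =
          sets (distr M (?C \<Otimes>\<^sub>M ?P) (\<lambda>\<omega>. (N \<omega>, \<lambda>i. X i \<omega>)))"
      by (simp, intro sets_pair_measure_cong) simp_all
    fix A E
    assume "A \<in> sets (distr M ?C N)" and "E \<in> sets (distr M ?P (\<lambda>\<omega> i. X i \<omega>))"
    then have A: "A \<in> sets ?C" and E: "E \<in> sets ?P" by simp_all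
    have "prob ((N -` A \<inter> space M) \<inter> ((\<lambda>\<omega> i. X i \<omega>) -` E \<inter> space M)) =
          prob (N -` A \<inter> space M) * prob ((\<lambda>\<omega> i. X i \<omega>) -` E \<inter> space M)"
      by (intro indep_setD[OF ind] in_vimage_algebra A E)
    moreover have "(\<lambda>\<omega>. (N \<omega>, \<lambda>i. X i \<omega>)) -` (A \<times> E) \<inter> space M =
          (N -` A \<inter> space M) \<inter> ((\<lambda>\<omega> i. X i \<omega>) -` E \<inter> space M)"
      by auto
    ultimately show "emeasure (distr M ?C N) A * emeasure (distr M ?P (\<lambda>\<omega> i. X i \<omega>)) E =
        emeasure (distr M (?C \<Otimes>\<^sub>M ?P) (\<lambda>\<omega>. (N \<omega>, \<lambda>i. X i \<omega>))) (A \<times> E)"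
      using A E N XX measurable_Pair[OF N XX]
      by (simp add: emeasure_distr emeasure_eq_measure ennreal_mult pair_measureI)
  qed
  have "random_sum_law (distr M ?C N) \<nu> =
        distr (distr M (?C \<Otimes>\<^sub>M ?P) (\<lambda>\<omega>. (N \<omega>, \<lambda>i. X i \<omega>))) ?C ?S"
    unfolding random_sum_law_def 2[symmetric] 1 ..
  also have "\<dots> = distr M ?C (?S \<circ> (\<lambda>\<omega>. (N \<omega>, \<lambda>i. X i \<omega>)))"
    by (rule distr_distr[OF measurable_random_sum measurable_Pair[OF N XX]])
  finally show ?thesis by (simp add: comp_def)
qed

(* D_law mu n is the law of D_n when mu is the law of B; indices start at n = 1 and
   D_law mu 0 is left unspecified. *)
fun D_law :: "nat measure \<Rightarrow> nat \<Rightarrow> nat measure" where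
  "D_law \<mu> (Suc 0) = \<mu>"
| "D_law \<mu> (Suc (Suc n)) = random_sum_law \<mu> (D_law \<mu> (Suc n))"

end

(*
  Write F for the tail of B. A sum of B independent copies of a summand D of mean m exceeds x
  essentially either because B exceeds x / m, or because a single summand exceeds x. By the weak
  law of large numbers the first event has probability about F(x / m) ~ m F(x). For a fixed number
  k of summands the second has probability about k P(D > x), and since F has index -1, truncating
  the summands at x and applying Chebyshev's inequality bounds P(D_1 + ... + D_k > x) by a constant
  times k F(x), uniformly in k <= (1 - delta) x / m. Dominated convergence then gives the
  contribution E(B) P(D > x). If D has tail c F, the random sum has tail (c E(B) + m) F, and
  induction on n finishes the proof.
*)
theory Submission
  imports Defs "HOL-Real_Asymp.Real_Asymp"
begin

text \<open>All tails are measured against the explicit function \<open>log_tail\<close>, to which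
  the hypothesis on L makes the tail of B equivalent; regular variation of index -1 then reduces to
  the limit of a concrete quotient. Two obstacles shape the estimates. A summand with such a tail
  has infinite variance, so Chebyshev's inequality helps only once the second moment truncated at x
  is known to be of order at most \<open>x\<^sup>2 * log_tail \<epsilon> x\<close>; the deviation
  term is then no larger in order than the single-jump term. And k is finally averaged over the law
  of B, of which only the mean is finite, so every uniform bound must be linear in k. The two
  contributions are separated by cutting the range of k at (1 - \<delta>) x / m and (1 + \<delta>) x
  / m. No estimate covers the window in between, but the probability that B falls into it is,
  relative to F(x), asymptotically m / (1 - \<delta>) - m / (1 + \<delta>). Hence \<delta> tends to
  0 only after x has tended to infinity.\<close>

definition tail :: "nat measure \<Rightarrow> real \<Rightarrow> real" where
  "tail N x = measure N {k. real k > x}"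

section \<open>Laws on the natural numbers and their i.i.d. copies\<close>

locale nat_law = prob_space N for N :: "nat measure" +
  assumes sets_N: "sets N = UNIV"
begin

text \<open>The product space occurring in \<open>random_sum_law\<close>, so that bounds for k
  summands carry over to the random sum by Fubini alone.\<close>

abbreviation P where "P \<equiv> (\<Pi>\<^sub>M i\<in>(UNIV :: nat set). N)"

sublocale P: product_prob_space "\<lambda>_::nat. N" UNIV ..

lemma space_N [simp]: "space N = UNIV"
  using sets.sets_into_space[of UNIV N] by (auto simp: sets_N)

lemma space_P [simp]: "space P = UNIV"
  by (simp add: space_PiM)

lemma prob_UNIV [simp]: "prob UNIV = 1" "P.prob UNIV = 1"
  using prob_space P.P.prob_space by simp_all

lemma sets_N_cong: "sets N = sets (count_space UNIV)"
  by (simp add: sets_N)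

lemma borel_measurable_N [measurable]: "g \<in> borel_measurable N"
  by (simp add: measurable_cong_sets[OF sets_N_cong refl])

lemma measurable_coordinate [measurable]: "(\<lambda>d. h (d i)) \<in> borel_measurable P"
  by (rule measurable_compose[where g = h and N = N]) (auto intro: measurable_component_singleton)

lemma measurable_coordinate_sum [measurable]: "(\<lambda>d. real (\<Sum>i<k. d i)) \<in> borel_measurable P"
  unfolding of_nat_sum by measurable

lemma distr_coordinate: "distr P N (\<lambda>d. d i) = N"
  by (rule P.PiM_component) simp

lemma integral_coordinate: "(\<integral>d. h (d i) \<partial>P) = (\<integral>k. h k \<partial>N)" for h :: "nat \<Rightarrow> real"
proof -
  have "(\<integral>k. h k \<partial>N) = (\<integral>k. h k \<partial>distr P N (\<lambda>d. d i))"
    by (simp add: distr_coordinate)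
  also have "\<dots> = (\<integral>d. h (d i) \<partial>P)"
    by (rule integral_distr) (auto intro: measurable_component_singleton)
  finally show ?thesis ..
qed

lemma integrable_coordinate:
  fixes h :: "nat \<Rightarrow> real"
  assumes "integrable N h"
  shows "integrable P (\<lambda>d. h (d i))"
proof -
  have "integrable (distr P N (\<lambda>d. d i)) h"
    using assms by (simp add: distr_coordinate)
  then show ?thesis
    by (rule integrable_distr[rotated]) (simp add: measurable_component_singleton)
qed

lemma prob_coordinate: "P.prob {d. d i \<in> A} = prob A"
  using measure_distr[of "\<lambda>d. d i" P N A]
  by (simp add: distr_coordinate sets_N measurable_component_singleton vimage_def)

lemma indep_coordinates: "P.indep_vars (\<lambda>_. N) (\<lambda>i d. d i) UNIV"
proof (subst P.indep_vars_iff_distr_eq_PiM')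
  show "distr P (\<Pi>\<^sub>M i\<in>UNIV. N) (\<lambda>d. \<lambda>i\<in>UNIV. d i) = (\<Pi>\<^sub>M i\<in>UNIV. distr P N (\<lambda>d. d i))"
    by (simp add: distr_coordinate restrict_def)
qed auto

lemma prob_coordinates: "P.prob {d. \<forall>i<k. d i \<in> A} = prob A ^ k"
proof (cases "k = 0")
  case True
  then show ?thesis
    using P.prob_space by simp
next
  \<comment> \<open>Independence gives the product rule over nonempty index sets only, whence the
    separate case.\<close>
  case False
  have "P.prob (\<Inter>i\<in>{..<k}. (\<lambda>d. d i) -` A \<inter> space P) = (\<Prod>i<k. P.prob ((\<lambda>d. d i) -` A \<inter> space P))"
    by (rule P.indep_varsD[OF indep_coordinates]) (use False in \<open>auto simp: sets_N\<close>)
  moreover have "(\<Inter>i\<in>{..<k}. (\<lambda>d. d i) -` A \<inter> space P) = {d. \<forall>i<k. d i \<in> A}"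
    using False by auto
  moreover have "P.prob ((\<lambda>d. d i) -` A \<inter> space P) = prob A" for i
    using prob_coordinate[of i A] by (simp add: vimage_def)
  ultimately show ?thesis
    by simp
qed

text \<open>Serves twice: with a centred \<open>h\<close> it removes the off-diagonal terms of a
  squared sum, and with an indicator it gives the probability that two summands are both
  large.\<close>

lemma integral_coordinate_mult:
  fixes h :: "nat \<Rightarrow> real"
  assumes "i \<noteq> j" and h: "integrable N h"
  shows "integrable P (\<lambda>d. h (d i) * h (d j))"
    and "(\<integral>d. h (d i) * h (d j) \<partial>P) = (\<integral>k. h k \<partial>N)\<^sup>2"
proof -
  have indep: "P.indep_vars (\<lambda>_. borel) (\<lambda>l d. h (d l)) {i, j}"
    by (rule P.indep_vars_compose2[OF P.indep_vars_subset[OF indep_coordinates]]) auto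
  have int: "integrable P (\<lambda>d. h (d l))" for l
    by (rule integrable_coordinate[OF h])
  show "integrable P (\<lambda>d. h (d i) * h (d j))"
    using P.indep_vars_integrable[OF _ indep int] assms(1) by simp
  show "(\<integral>d. h (d i) * h (d j) \<partial>P) = (\<integral>k. h k \<partial>N)\<^sup>2"
    using P.indep_vars_lebesgue_integral[OF _ indep int] assms(1)
    by (simp add: integral_coordinate power2_eq_square)
qed

text \<open>Chebyshev's inequality, with the variance bounded by the second moment. The bound
  \<open>K\<close> only secures integrability and does not enter the estimate, so \<open>f\<close>
  may be truncated at a level that grows with x.\<close>

lemma truncated_sum_deviation:
  fixes f :: "nat \<Rightarrow> real"
  assumes bounded: "\<And>j. \<bar>f j\<bar> \<le> K" and "a > 0"
  shows "P.prob {d. \<bar>(\<Sum>i<k. f (d i)) - real k * (\<integral>j. f j \<partial>N)\<bar> \<ge> a} \<le> real k * (\<integral>j. (f j)\<^sup>2 \<partial>N) / a\<^sup>2"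
proof -
  define e where "e = (\<integral>j. f j \<partial>N)"
  define h where "h j = f j - e" for j
  have bound_int: "integrable N g" if "\<And>j. \<bar>g j\<bar> \<le> C" for g :: "nat \<Rightarrow> real" and C
    by (rule integrable_const_bound[where B = C]) (use that in auto)
  have f: "integrable N f"
    by (rule bound_int[OF bounded])
  have f2: "integrable N (\<lambda>j. (f j)\<^sup>2)"
  proof (rule bound_int)
    show "\<bar>(f j)\<^sup>2\<bar> \<le> K\<^sup>2" for j
      using power_mono[OF bounded abs_ge_zero, of j 2] by simp
  qed
  have h: "integrable N h" and h0: "(\<integral>j. h j \<partial>N) = 0"
    unfolding h_def using f by (simp_all add: e_def)
  have h2: "integrable N (\<lambda>j. (h j)\<^sup>2)"
    unfolding h_def power2_diff using f f2 by simp
  have "(\<integral>j. (h j)\<^sup>2 \<partial>N) = (\<integral>j. (f j)\<^sup>2 \<partial>N) - e\<^sup>2"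
    unfolding h_def e_def by (rule variance_eq[OF f f2])
  then have h2_le: "(\<integral>j. (h j)\<^sup>2 \<partial>N) \<le> (\<integral>j. (f j)\<^sup>2 \<partial>N)"
    by simp
  have prod_int: "integrable P (\<lambda>d. h (d i) * h (d j))" for i j
    using integral_coordinate_mult(1)[OF _ h, of i j] integrable_coordinate[OF h2, of i]
    by (cases "i = j") (simp_all add: power2_eq_square)
  have prod: "(\<integral>d. h (d i) * h (d j) \<partial>P) = (if i = j then \<integral>j. (h j)\<^sup>2 \<partial>N else 0)" for i j
    using integral_coordinate_mult(2)[OF _ h, of i j] integral_coordinate[of "\<lambda>j. (h j)\<^sup>2" i]
    by (auto simp: power2_eq_square h0)
  have square: "(\<Sum>i<k. h (d i))\<^sup>2 = (\<Sum>i<k. \<Sum>j<k. h (d i) * h (d j))" for d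
    by (simp add: power2_eq_square sum_product)
  have "(\<integral>d. (\<Sum>i<k. h (d i))\<^sup>2 \<partial>P) = real k * (\<integral>j. (h j)\<^sup>2 \<partial>N)"
    unfolding square by (simp add: prod_int prod)
  moreover have "P.prob {d \<in> space P. \<bar>\<Sum>i<k. h (d i)\<bar> \<ge> a} \<le> (\<integral>d. (\<Sum>i<k. h (d i))\<^sup>2 \<partial>P) / a\<^sup>2"
    by (rule P.second_moment_method) (use \<open>a > 0\<close> prod_int in \<open>auto simp: square\<close>)
  moreover have "(\<Sum>i<k. h (d i)) = (\<Sum>i<k. f (d i)) - real k * e" for d
    by (simp add: h_def sum_subtractf)
  ultimately show ?thesis
    using h2_le by (simp add: e_def order_trans[OF _ divide_right_mono] mult_left_mono)
qed

section \<open>Non-asymptotic bounds for a sum of k copies\<close>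

definition sum_tail :: "nat \<Rightarrow> real \<Rightarrow> real" where
  "sum_tail k x = P.prob {d. real (\<Sum>i<k. d i) > x}"

definition truncated_moment :: "real \<Rightarrow> real" where
  "truncated_moment x = (\<integral>j. (if real j \<le> x then real j else 0)\<^sup>2 \<partial>N)"

lemma tail_nonneg: "0 \<le> tail N x" and tail_le_1: "tail N x \<le> 1"
  by (simp_all add: tail_def)

lemma sum_tail_nonneg: "0 \<le> sum_tail k x" and sum_tail_le_1: "sum_tail k x \<le> 1"
  by (simp_all add: sum_tail_def)

lemma sets_P_sum: "{d. real (\<Sum>i<k. d i) > x} \<in> P.events"
proof -
  have "{d \<in> space P. real (\<Sum>i<k. d i) > x} \<in> P.events"
    by measurable
  then show ?thesis
    by simp
qed

lemma sets_P_coordinate: "{d. Q (d i)} \<in> P.events"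
proof -
  have "{d \<in> space P. Q (d i)} \<in> P.events"
    using measurable_sets[OF measurable_component_singleton[of i UNIV "\<lambda>_. N"], of "{j. Q j}"]
    by (simp add: sets_N vimage_def)
  then show ?thesis
    by simp
qed

lemma sets_P_sum_real: "{d. Q (\<Sum>i<k. f (d i))} \<in> P.events"
  if "{y. Q y} \<in> sets borel" for f :: "nat \<Rightarrow> real"
proof -
  have "(\<lambda>d. \<Sum>i<k. f (d i)) -` {y. Q y} \<inter> space P \<in> P.events"
    by (rule measurable_sets[OF _ that]) measurable
  then show ?thesis
    by (simp add: vimage_def)
qed

text \<open>Summands are nonnegative, so a sum of at most x forces each of them to be at most x, and
  independence turns this into a power.\<close>

lemma sum_tail_ge: "1 - (1 - tail N x) ^ k \<le> sum_tail k x"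
proof -
  have "prob {j. real j \<le> x} = 1 - tail N x"
    using prob_compl[of "{j. real j > x}"]
    by (simp add: tail_def sets_N Compl_eq_Diff_UNIV[symmetric] Collect_neg_eq[symmetric] not_less)
  moreover have "{d. \<forall>i<k. d i \<in> {j. real j \<le> x}} \<supseteq> UNIV - {d. real (\<Sum>i<k. d i) > x}"
  proof
    fix d assume "d \<in> UNIV - {d. real (\<Sum>i<k. d i) > x}"
    then have le: "real (\<Sum>i<k. d i) \<le> x"
      by simp
    have "real (d i) \<le> x" if "i < k" for i
    proof -
      have "d i \<le> (\<Sum>i<k. d i)"
        using that by (intro member_le_sum) auto
      then show ?thesis
        using le by linarith
    qed
    then show "d \<in> {d. \<forall>i<k. d i \<in> {j. real j \<le> x}}"
      by simp
  qed
  then have "P.prob (UNIV - {d. real (\<Sum>i<k. d i) > x}) \<le> P.prob {d. \<forall>i<k. d i \<in> {j. real j \<le> x}}"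
  proof (rule P.finite_measure_mono)
    have "(\<Inter>i\<in>{..<k}. {d. d i \<in> {j. real j \<le> x}}) \<in> P.events" if "k \<noteq> 0"
      by (rule sets.finite_INT) (use that sets_P_coordinate in auto)
    moreover have "{d. \<forall>i<k. d i \<in> {j. real j \<le> x}} = (\<Inter>i\<in>{..<k}. {d. d i \<in> {j. real j \<le> x}})"
      by auto
    ultimately show "{d. \<forall>i<k. d i \<in> {j. real j \<le> x}} \<in> P.events"
      using sets.top[of P] by (cases "k = 0") simp_all
  qed
  moreover have "P.prob (UNIV - {d. real (\<Sum>i<k. d i) > x}) = 1 - sum_tail k x"
    using P.prob_compl[OF sets_P_sum, of x k] by (simp add: sum_tail_def)
  ultimately show ?thesis
    using prob_coordinates[of k "{j. real j \<le> x}"] by simp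
qed

lemma prob_coordinate_pair:
  assumes "i \<noteq> j"
  shows "P.prob {d. d i \<in> A \<and> d j \<in> A} = (prob A)\<^sup>2"
proof -
  have "integrable N (indicat_real A)"
    by (simp add: sets_N emeasure_eq_measure)
  then have "(\<integral>d. indicat_real A (d i) * indicat_real A (d j) \<partial>P) = (\<integral>k. indicat_real A k \<partial>N)\<^sup>2"
    by (rule integral_coordinate_mult(2)[OF assms])
  moreover have "indicat_real A (d i) * indicat_real A (d j) = indicat_real {d. d i \<in> A \<and> d j \<in> A} d" for d
    by (auto simp: indicator_def)
  ultimately show ?thesis
    by simp
qed

text \<open>A sum above x needs either one summand above (1 - \<delta>) x or two summands above
  \<delta> x / k: otherwise all summands but the largest add up to at most \<delta> x. By
  independence the second event costs a squared tail, which is negligible for fixed k.\<close>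

lemma sum_tail_le_fixed:
  assumes "x > 0" and "\<delta> > 0"
  shows "sum_tail k x \<le> real k * tail N ((1 - \<delta>) * x) + (real k)\<^sup>2 * (tail N (\<delta> * x / real k))\<^sup>2"
proof -
  define U where "U = (\<Union>i<k. {d :: nat \<Rightarrow> nat. d i \<in> {j. real j > (1 - \<delta>) * x}})"
  define A where "A = {j. real j > \<delta> * x / real k}"
  define V where "V = (\<Union>(i, j)\<in>{..<k} \<times> {..<k} - Id. {d :: nat \<Rightarrow> nat. d i \<in> A \<and> d j \<in> A})"
  have pair_sets: "{d. d i \<in> A \<and> d j \<in> A} \<in> P.events" for i j
    using sets.Int[OF sets_P_coordinate sets_P_coordinate, of "\<lambda>n. n \<in> A" i "\<lambda>n. n \<in> A" j]
    by (simp add: Collect_conj_eq)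
  have U: "U \<in> P.events"
    unfolding U_def by (intro sets.finite_UN sets_P_coordinate) auto
  have V: "V \<in> P.events"
    unfolding V_def by (intro sets.finite_UN) (auto simp: pair_sets split: prod.splits)
  have "{d. real (\<Sum>i<k. d i) > x} \<subseteq> U \<union> V"
  proof
    fix d assume "d \<in> {d. real (\<Sum>i<k. d i) > x}"
    then have gt: "(\<Sum>i<k. real (d i)) > x"
      by simp
    then have "k > 0"
      using \<open>x > 0\<close> by (cases "k = 0") auto
    show "d \<in> U \<union> V"
    proof (rule ccontr)
      assume not: "d \<notin> U \<union> V"
      have "Max (d ` {..<k}) \<in> d ` {..<k}"
        by (rule Max_in) (use \<open>k > 0\<close> in auto)
      then obtain i where i: "i < k" "d i = Max (d ` {..<k})"
        by auto
      have max: "d j \<le> d i" if "j < k" for j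
        unfolding i(2) using that by simp
      \<comment> \<open>If another summand exceeded the threshold, so would the maximum, and the two
        together would put \<open>d\<close> into \<open>V\<close>.\<close>
      have other: "real (d j) \<le> \<delta> * x / real k" if "j \<in> {..<k} - {i}" for j
      proof (rule ccontr)
        assume "\<not> ?thesis"
        then have "d j \<in> A" "d i \<in> A"
          using max[of j] that by (auto simp: A_def intro: less_le_trans)
        then show False
          using not that i(1) by (auto simp: V_def)
      qed
      have "(\<Sum>i<k. real (d i)) = real (d i) + (\<Sum>j\<in>{..<k} - {i}. real (d j))"
        using i(1) by (simp add: sum.remove)
      also have "real (d i) \<le> (1 - \<delta>) * x"
        using not i(1) by (auto simp: U_def not_less)
      also have "(\<Sum>j\<in>{..<k} - {i}. real (d j)) \<le> real (card ({..<k} - {i})) * (\<delta> * x / real k)"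
        by (rule sum_bounded_above[OF other])
      also have "\<dots> \<le> real k * (\<delta> * x / real k)"
        using i(1) assms by (intro mult_right_mono) auto
      also have "\<dots> = \<delta> * x"
        using \<open>k > 0\<close> by simp
      finally show False
        using gt by (simp add: algebra_simps)
    qed
  qed
  then have "sum_tail k x \<le> P.prob U + P.prob V"
    unfolding sum_tail_def by (intro order_trans[OF P.finite_measure_mono measure_Un_le] sets.Un U V)
  also have "P.prob U \<le> (\<Sum>i<k. P.prob {d. d i \<in> {j. real j > (1 - \<delta>) * x}})"
    unfolding U_def by (intro measure_UNION_le sets_P_coordinate) auto
  also have "\<dots> = real k * tail N ((1 - \<delta>) * x)"
    by (simp only: prob_coordinate) (simp add: tail_def)
  also have "P.prob V \<le> (\<Sum>(i, j)\<in>{..<k} \<times> {..<k} - Id. P.prob {d. d i \<in> A \<and> d j \<in> A})"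
    unfolding V_def using pair_sets
    by (intro order_trans[OF measure_UNION_le]) (auto intro!: sum_mono split: prod.splits)
  also have "\<dots> = (\<Sum>(i, j)\<in>{..<k} \<times> {..<k} - Id. (prob A)\<^sup>2)"
  proof (intro sum.cong refl)
    show "(case p of (i, j) \<Rightarrow> P.prob {d. d i \<in> A \<and> d j \<in> A}) = (case p of (i, j) \<Rightarrow> (prob A)\<^sup>2)"
      if "p \<in> {..<k} \<times> {..<k} - Id" for p
      using that by (cases p) (simp add: prob_coordinate_pair)
  qed
  also have "\<dots> = real (card ({..<k} \<times> {..<k} - Id)) * (prob A)\<^sup>2"
    by (simp add: case_prod_beta)
  also have "\<dots> \<le> real (card ({..<k} \<times> {..<k})) * (prob A)\<^sup>2"
    by (intro mult_right_mono of_nat_mono card_mono) auto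
  also have "\<dots> = (real k)\<^sup>2 * (tail N (\<delta> * x / real k))\<^sup>2"
    by (simp add: A_def tail_def power2_eq_square)
  finally show ?thesis
    by simp
qed

lemma truncated_mean_le:
  assumes "integrable N real"
  shows "(\<integral>j. (if real j \<le> x then real j else 0) \<partial>N) \<le> (\<integral>j. real j \<partial>N)"
  using assms by (intro integral_mono Bochner_Integration.integrable_bound[OF assms]) auto

text \<open>If no summand exceeds x, truncation changes nothing. The truncated sum has mean at most
  (1 - \<delta>) x by the restriction on k, so passing x means a deviation of at least \<delta> x.
  Both the union bound and the variance are linear in k.\<close>

lemma sum_tail_le_uniform:
  assumes int: "integrable N real" and "x > 0" and "\<delta> > 0"
    and k: "real k * (\<integral>j. real j \<partial>N) \<le> (1 - \<delta>) * x"
  shows "sum_tail k x \<le> real k * (tail N x + truncated_moment x / (\<delta> * x)\<^sup>2)"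
proof -
  define f where "f j = (if real j \<le> x then real j else 0)" for j
  define e where "e = (\<integral>j. f j \<partial>N)"
  define U where "U = (\<Union>i<k. {d :: nat \<Rightarrow> nat. d i \<in> {j. real j > x}})"
  define V where "V = {d. \<bar>(\<Sum>i<k. f (d i)) - real k * e\<bar> \<ge> \<delta> * x}"
  have U: "U \<in> P.events"
    unfolding U_def by (intro sets.finite_UN sets_P_coordinate) auto
  have V: "V \<in> P.events"
    unfolding V_def by (rule sets_P_sum_real) measurable
  have "real k * e \<le> (1 - \<delta>) * x"
    using mult_left_mono[OF truncated_mean_le[OF int], of "real k" x] k by (simp add: e_def f_def)
  have "{d. real (\<Sum>i<k. d i) > x} \<subseteq> U \<union> V"
  proof
    fix d assume "d \<in> {d. real (\<Sum>i<k. d i) > x}"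
    then have gt: "(\<Sum>i<k. real (d i)) > x"
      by simp
    have "(\<Sum>i<k. f (d i)) - real k * e \<ge> \<delta> * x" if "d \<notin> U"
    proof -
      have "(\<Sum>i<k. f (d i)) = (\<Sum>i<k. real (d i))"
        using that by (intro sum.cong) (auto simp: f_def U_def not_less)
      then show ?thesis
        using gt \<open>real k * e \<le> (1 - \<delta>) * x\<close> by (simp add: algebra_simps)
    qed
    then show "d \<in> U \<union> V"
      unfolding V_def by force
  qed
  then have "sum_tail k x \<le> P.prob U + P.prob V"
    unfolding sum_tail_def by (intro order_trans[OF P.finite_measure_mono measure_Un_le] sets.Un U V)
  also have "P.prob U \<le> (\<Sum>i<k. P.prob {d. d i \<in> {j. real j > x}})"
    unfolding U_def by (intro measure_UNION_le sets_P_coordinate) auto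
  also have "\<dots> = real k * tail N x"
    by (simp only: prob_coordinate) (simp add: tail_def)
  also have "P.prob V \<le> real k * (\<integral>j. (f j)\<^sup>2 \<partial>N) / (\<delta> * x)\<^sup>2"
    unfolding V_def e_def
    by (rule truncated_sum_deviation[where K = x]) (use assms in \<open>auto simp: f_def\<close>)
  finally show ?thesis
    by (simp add: truncated_moment_def f_def distrib_left)
qed

text \<open>Only a first moment is available, so the summands are truncated at a fixed level
  \<open>A\<close> whose truncated mean still exceeds \<theta>. Truncation lowers the sum, and
  Chebyshev's inequality for bounded summands supplies the rate 1 / k.\<close>

lemma sum_tail_law_of_large_numbers:
  assumes int: "integrable N real" and \<theta>: "\<theta> < (\<integral>j. real j \<partial>N)"
  obtains C where "\<And>k x. k > 0 \<Longrightarrow> x \<le> \<theta> * real k \<Longrightarrow> 1 - C / real k \<le> sum_tail k x"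
proof -
  have "(\<lambda>A. \<integral>j. (if j \<le> A then real j else 0) \<partial>N) \<longlonglongrightarrow> (\<integral>j. real j \<partial>N)"
  proof (rule integral_dominated_convergence[OF _ _ int])
    show "AE j in N. (\<lambda>A. if j \<le> A then real j else 0) \<longlonglongrightarrow> real j"
    proof (rule AE_I2)
      show "(\<lambda>A. if j \<le> A then real j else 0) \<longlonglongrightarrow> real j" for j
        by (rule tendsto_eventually) (auto intro: eventually_mono[OF eventually_ge_at_top[of j]])
    qed
  qed auto
  from order_tendstoD(1)[OF this \<theta>]
  obtain A where A: "(\<integral>j. (if j \<le> A then real j else 0) \<partial>N) > \<theta>"
    by (auto simp: eventually_sequentially)
  define f where "f j = (if j \<le> A then real j else 0)" for j
  define e where "e = (\<integral>j. f j \<partial>N)"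
  define C where "C = (\<integral>j. (f j)\<^sup>2 \<partial>N) / (e - \<theta>)\<^sup>2"
  have "e > \<theta>"
    using A by (simp add: e_def f_def)
  have "1 - C / real k \<le> sum_tail k x" if "k > 0" and "x \<le> \<theta> * real k" for k x
  proof -
    define V where "V = {d. \<bar>(\<Sum>i<k. f (d i)) - real k * e\<bar> \<ge> real k * (e - \<theta>)}"
    have V: "V \<in> P.events"
      unfolding V_def by (rule sets_P_sum_real) measurable
    \<comment> \<open>A sum of at most \<theta> k leaves the truncated sum short of its mean k e by
      at least k (e - \<theta>).\<close>
    have "UNIV - {d. real (\<Sum>i<k. d i) > x} \<subseteq> V"
    proof
      fix d assume "d \<in> UNIV - {d. real (\<Sum>i<k. d i) > x}"
      then have "(\<Sum>i<k. real (d i)) \<le> x"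
        by simp
      moreover have "(\<Sum>i<k. f (d i)) \<le> (\<Sum>i<k. real (d i))"
        by (intro sum_mono) (simp add: f_def)
      ultimately show "d \<in> V"
        using that by (auto simp: V_def algebra_simps)
    qed
    then have "P.prob (UNIV - {d. real (\<Sum>i<k. d i) > x}) \<le> P.prob V"
      by (rule P.finite_measure_mono[OF _ V])
    also have "\<dots> \<le> real k * (\<integral>j. (f j)\<^sup>2 \<partial>N) / (real k * (e - \<theta>))\<^sup>2"
      unfolding V_def e_def
      by (rule truncated_sum_deviation[where K = A])
        (use \<open>e > \<theta>\<close> that in \<open>auto simp: f_def simp flip: e_def\<close>)
    also have "\<dots> = C / real k"
      using that by (simp add: C_def power_mult_distrib power2_eq_square)
    also have "P.prob (UNIV - {d. real (\<Sum>i<k. d i) > x}) = 1 - sum_tail k x"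
      using P.prob_compl[OF sets_P_sum, of x k] by (simp add: sum_tail_def)
    finally show ?thesis
      by simp
  qed
  then show thesis
    by (rule that)
qed

text \<open>Summation by parts: the square of k is the sum of the odd numbers 2 j + 1 over j < k,
  and the event j < k has the tail at j as its probability.\<close>

lemma truncated_moment_le_sum:
  "truncated_moment x \<le> (\<Sum>j | real j \<le> x. (2 * real j + 1) * tail N (real j))"
proof -
  have fin: "finite {j. real j \<le> x}"
    by (rule finite_subset[of _ "{..nat \<lfloor>x\<rfloor>}"]) (auto simp: le_nat_floor)
  have ind_int: "integrable N (indicat_real {k. real k > y})" for y
    by (simp add: sets_N emeasure_eq_measure)
  have square: "(real k)\<^sup>2 = (\<Sum>j<k. 2 * real j + 1)" for k
    by (induction k) (simp_all add: power2_eq_square algebra_simps)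
  have "truncated_moment x \<le> (\<integral>k. (\<Sum>j | real j \<le> x. (2 * real j + 1) * indicat_real {k. real k > real j} k) \<partial>N)"
    unfolding truncated_moment_def
  proof (rule integral_mono)
    show "integrable N (\<lambda>j. (if real j \<le> x then real j else 0)\<^sup>2)"
      by (rule integrable_const_bound[where B = "x\<^sup>2"]) (auto intro!: power_mono)
    show "integrable N (\<lambda>k. \<Sum>j | real j \<le> x. (2 * real j + 1) * indicat_real {k. real k > real j} k)"
      by (intro Bochner_Integration.integrable_sum integrable_mult_right ind_int)
    show "(if real k \<le> x then real k else 0)\<^sup>2 \<le> (\<Sum>j | real j \<le> x. (2 * real j + 1) * indicat_real {k. real k > real j} k)" for k
    proof (cases "real k \<le> x")
      case True
      have "(\<Sum>j<k. 2 * real j + 1) = (\<Sum>j<k. (2 * real j + 1) * indicat_real {k. real k > real j} k)"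
        by (intro sum.cong) auto
      also have "\<dots> \<le> (\<Sum>j | real j \<le> x. (2 * real j + 1) * indicat_real {k. real k > real j} k)"
        by (intro sum_mono2 fin) (use True in auto)
      finally show ?thesis
        using True by (simp add: square)
    qed (simp add: sum_nonneg)
  qed
  also have "\<dots> = (\<Sum>j | real j \<le> x. (2 * real j + 1) * tail N (real j))"
    by (subst Bochner_Integration.integral_sum, intro integrable_mult_right ind_int) (simp add: tail_def)
  finally show ?thesis .
qed

lemma tail_Markov:
  assumes "integrable N real" and "x > 0"
  shows "x * tail N x \<le> (\<integral>j. real j \<partial>N)"
proof -
  have "tail N x = (\<integral>j. indicat_real {k. real k > x} j \<partial>N)"
    by (simp add: tail_def)
  then have "x * tail N x = (\<integral>j. x * indicat_real {k. real k > x} j \<partial>N)"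
    by (simp)
  also have "\<dots> \<le> (\<integral>j. real j \<partial>N)"
  proof (rule integral_mono[OF _ assms(1)])
    show "integrable N (\<lambda>j. x * indicat_real {k. real k > x} j)"
      by (rule integrable_mult_right) (simp add: sets_N emeasure_eq_measure)
  qed (use assms in \<open>auto simp: indicator_def\<close>)
  finally show ?thesis .
qed

end

section \<open>The comparison function and tools for limits\<close>

definition log_tail :: "real \<Rightarrow> real \<Rightarrow> real" where
  "log_tail \<epsilon> x = 1 / (x * ln x powr (1 + \<epsilon>))"

lemma log_tail_pos: "x > 1 \<Longrightarrow> log_tail \<epsilon> x > 0"
  by (simp add: log_tail_def)

lemma eventually_log_tail_pos: "eventually (\<lambda>x. log_tail \<epsilon> x > 0) at_top"
  using eventually_gt_at_top[of 1] by eventually_elim (rule log_tail_pos)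

text \<open>The function \<open>log_tail\<close> varies regularly with index -1, so stretching the
  argument by t costs the factor 1 / t. This is what turns P(B > x / m) into m P(B > x).\<close>

lemma tendsto_ratio_scale:
  assumes "((\<lambda>x. f x / log_tail \<epsilon> x) \<longlongrightarrow> c) at_top" and "t > 0"
  shows "((\<lambda>x. f (t * x) / log_tail \<epsilon> x) \<longlongrightarrow> c / t) at_top"
proof -
  have "filterlim (\<lambda>x. t * x) at_top at_top"
    using \<open>t > 0\<close> by real_asymp
  with assms(1) have "((\<lambda>x. f (t * x) / log_tail \<epsilon> (t * x)) \<longlongrightarrow> c) at_top"
    by (rule filterlim_compose)
  moreover have "((\<lambda>x. log_tail \<epsilon> (t * x) / log_tail \<epsilon> x) \<longlongrightarrow> 1 / t) at_top"
    unfolding log_tail_def using \<open>t > 0\<close> by (real_asymp simp: field_simps)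
  ultimately have "((\<lambda>x. f (t * x) / log_tail \<epsilon> (t * x) * (log_tail \<epsilon> (t * x) / log_tail \<epsilon> x)) \<longlongrightarrow> c * (1 / t)) at_top"
    by (rule tendsto_mult)
  moreover have "eventually (\<lambda>x. log_tail \<epsilon> (t * x) > 0) at_top"
    using eventually_log_tail_pos \<open>filterlim (\<lambda>x. t * x) at_top at_top\<close>
    by (rule eventually_compose_filterlim)
  then have "eventually (\<lambda>x. f (t * x) / log_tail \<epsilon> (t * x) * (log_tail \<epsilon> (t * x) / log_tail \<epsilon> x) =
      f (t * x) / log_tail \<epsilon> x) at_top"
    by eventually_elim simp
  ultimately show ?thesis
    by (auto intro: Lim_transform_eventually)
qed

text \<open>The bounds for a fixed \<delta> do not match, not even in the limit; only their limits
  do as \<delta> tends to 0. No \<delta> depending on x has to be chosen.\<close>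

lemma tendsto_sandwich_family:
  fixes f :: "real \<Rightarrow> real" and l u :: "real \<Rightarrow> real \<Rightarrow> real"
  assumes sandwich: "\<And>\<delta>. 0 < \<delta> \<Longrightarrow> \<delta> < 1 \<Longrightarrow> eventually (\<lambda>x. l \<delta> x \<le> f x \<and> f x \<le> u \<delta> x) F"
    and l: "\<And>\<delta>. 0 < \<delta> \<Longrightarrow> \<delta> < 1 \<Longrightarrow> (l \<delta> \<longlongrightarrow> l' \<delta>) F"
    and u: "\<And>\<delta>. 0 < \<delta> \<Longrightarrow> \<delta> < 1 \<Longrightarrow> (u \<delta> \<longlongrightarrow> u' \<delta>) F"
    and l': "(l' \<longlongrightarrow> a) (at_right 0)" and u': "(u' \<longlongrightarrow> a) (at_right 0)"
  shows "(f \<longlongrightarrow> a) F"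
proof (rule order_tendstoI)
  have small: "eventually (\<lambda>\<delta>::real. 0 < \<delta> \<and> \<delta> < 1) (at_right 0)"
    by (simp add: eventually_at_right_field) (metis less_numeral_extra(1))
  fix y
  {
    assume "y < a"
    from eventually_conj[OF order_tendstoD(1)[OF l' this] small]
    obtain \<delta> where \<delta>: "y < l' \<delta>" "0 < \<delta>" "\<delta> < 1"
      using eventually_happens trivial_limit_at_right_real by blast
    from order_tendstoD(1)[OF l[OF \<delta>(2,3)] \<delta>(1)] sandwich[OF \<delta>(2,3)]
    show "eventually (\<lambda>x. y < f x) F"
      by eventually_elim auto
  next
    assume "a < y"
    from eventually_conj[OF order_tendstoD(2)[OF u' this] small]
    obtain \<delta> where \<delta>: "u' \<delta> < y" "0 < \<delta>" "\<delta> < 1"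
      using eventually_happens trivial_limit_at_right_real by blast
    from order_tendstoD(2)[OF u[OF \<delta>(2,3)] \<delta>(1)] sandwich[OF \<delta>(2,3)]
    show "eventually (\<lambda>x. f x < y) F"
      by eventually_elim auto
  }
qed

lemma card_nat_le_real:
  assumes "x \<ge> 0"
  shows "finite {j::nat. real j \<le> x}" and "real (card {j::nat. real j \<le> x}) \<le> x + 1"
proof -
  have eq: "{j::nat. real j \<le> x} = {..nat \<lfloor>x\<rfloor>}"
    using assms by (auto simp: le_nat_floor) linarith
  show "finite {j::nat. real j \<le> x}"
    by (simp add: eq)
  show "real (card {j::nat. real j \<le> x}) \<le> x + 1"
    using assms unfolding eq by simp
qed

text \<open>This is the difference quotient at 0 of 1 - (1 - p)^k. With p a tail tending to 0 from
  above, it makes the lower bound \<open>sum_tail_ge\<close> sharp to first order.\<close>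

lemma tendsto_one_minus_power_ratio:
  "((\<lambda>p::real. (1 - (1 - p) ^ k) / p) \<longlongrightarrow> real k) (at_right 0)"
proof -
  have "((\<lambda>p::real. 1 - (1 - p) ^ k) has_real_derivative real k) (at 0)"
    by (auto intro!: derivative_eq_intros)
  then have "((\<lambda>p::real. (1 - (1 - p) ^ k) / p) \<longlongrightarrow> real k) (at 0)"
    by (simp add: has_field_derivative_iff)
  then show ?thesis
    by (rule filterlim_mono) (auto simp: at_le)
qed

section \<open>Sums of k copies when the summand has tail asymptotic to c times the comparison
  function\<close>

context nat_law
begin

context
  fixes \<epsilon> c :: real
  assumes eps: "\<epsilon> > 0"
    and c: "c > 0"
    and mean: "integrable N real"
    and tail: "((\<lambda>x. tail N x / log_tail \<epsilon> x) \<longlongrightarrow> c) at_top"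
begin

lemma eventually_tail_le: "eventually (\<lambda>x. tail N x \<le> 2 * c * log_tail \<epsilon> x) at_top"
proof -
  have "eventually (\<lambda>x. tail N x / log_tail \<epsilon> x < 2 * c) at_top"
    by (rule order_tendstoD(2)[OF tail]) (use c in simp)
  then show ?thesis
    using eventually_log_tail_pos[of \<epsilon>] by eventually_elim (simp add: field_simps)
qed

lemma eventually_tail_pos: "eventually (\<lambda>x. tail N x > 0) at_top"
proof -
  have "eventually (\<lambda>x. tail N x / log_tail \<epsilon> x > 0) at_top"
    by (rule order_tendstoD(1)[OF tail c])
  then show ?thesis
    using eventually_log_tail_pos[of \<epsilon>] by eventually_elim (simp add: zero_less_divide_iff)
qed

lemma log_tail_tendsto_0: "(log_tail \<epsilon> \<longlongrightarrow> 0) at_top"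
  unfolding log_tail_def[abs_def] using eps by real_asymp

lemma tail_tendsto_0: "(tail N \<longlongrightarrow> 0) at_top"
proof -
  have "((\<lambda>x. tail N x / log_tail \<epsilon> x * log_tail \<epsilon> x) \<longlongrightarrow> c * 0) at_top"
    by (rule tendsto_mult[OF tail log_tail_tendsto_0])
  moreover have "eventually (\<lambda>x. tail N x / log_tail \<epsilon> x * log_tail \<epsilon> x = tail N x) at_top"
    using eventually_log_tail_pos[of \<epsilon>] by eventually_elim simp
  ultimately show ?thesis
    by (auto intro: Lim_transform_eventually)
qed

(* Splitting the sum over j at sqrt x keeps ln j comparable to ln x on the dominant part. *)
lemma eventually_truncated_moment_le:
  obtains C where "eventually (\<lambda>x. truncated_moment x \<le> C * (x\<^sup>2 * log_tail \<epsilon> x)) at_top"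
proof -
  define m where "m = (\<integral>j. real j \<partial>N)"
  define K where "K = 1 + 3 * m"
  \<comment> \<open>The factor 6 c combines 2 j + 1 \<le> 3 j with the eventual bound 2 c for the
    ratio of the tail to \<open>log_tail\<close>; ln x / 2 is the logarithm of sqrt x.\<close>
  define T where "T x = 6 * c / (ln x / 2) powr (1 + \<epsilon>)" for x
  have "m \<ge> 0"
    by (simp add: m_def)
  \<comment> \<open>Markov's inequality bounds j times the tail at j by m. The at most sqrt x + 1
    terms up to sqrt x thus contribute only O(sqrt x).\<close>
  have small: "(2 * real j + 1) * tail N (real j) \<le> K" for j
  proof (cases "j = 0")
    case False
    then have "real j * tail N (real j) \<le> m"
      unfolding m_def by (intro tail_Markov mean) simp
    moreover have "tail N (real j) \<le> 1"
      by (rule tail_le_1)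
    ultimately show ?thesis
      using \<open>m \<ge> 0\<close> by (simp add: K_def algebra_simps)
  qed (use \<open>m \<ge> 0\<close> tail_le_1[of 0] in \<open>simp add: K_def\<close>)
  from eventually_tail_le obtain X where X: "\<And>x. x \<ge> X \<Longrightarrow> tail N x \<le> 2 * c * log_tail \<epsilon> x"
    by (auto simp: eventually_at_top_linorder)
  have bound: "truncated_moment x \<le> (sqrt x + 1) * K + (x + 1) * T x" if "x > 1" "sqrt x \<ge> X" for x
  proof -
    have large: "(2 * real j + 1) * tail N (real j) \<le> T x" if "real j > sqrt x" for j
    proof -
      have j: "real j > 1"
        using that \<open>x > 1\<close> by (meson less_trans real_sqrt_gt_1_iff)
      have "ln x / 2 = ln (sqrt x)"
        using \<open>x > 1\<close> by (simp add: ln_sqrt)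
      also have "\<dots> \<le> ln (real j)"
        using that j \<open>x > 1\<close> by (subst ln_le_cancel_iff) auto
      finally have ln: "ln x / 2 \<le> ln (real j)" .
      have "(2 * real j + 1) * tail N (real j) \<le> (3 * real j) * (2 * c * log_tail \<epsilon> (real j))"
        using j that \<open>sqrt x \<ge> X\<close> by (intro mult_mono X tail_nonneg) auto
      also have "\<dots> = 6 * c / ln (real j) powr (1 + \<epsilon>)"
        using j by (simp add: log_tail_def)
      also have "\<dots> \<le> T x"
        unfolding T_def using ln \<open>x > 1\<close> eps c
        by (intro divide_left_mono powr_mono2 mult_pos_pos) auto
      finally show ?thesis .
    qed
    have "T x \<ge> 0"
      using c by (simp add: T_def)
    have "K \<ge> 0"
      using \<open>m \<ge> 0\<close> by (simp add: K_def)
    have "x \<ge> 0" "sqrt x \<ge> 0" "sqrt x \<le> x"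
      using \<open>x > 1\<close> by (auto simp: sqrt_le_D real_le_lsqrt power2_eq_square)
    let ?A = "{j::nat. real j \<le> sqrt x}" and ?B = "{j::nat. real j \<le> x}"
    have "truncated_moment x \<le> (\<Sum>j\<in>?B. (2 * real j + 1) * tail N (real j))"
      by (rule truncated_moment_le_sum)
    also have "\<dots> = (\<Sum>j\<in>?A. (2 * real j + 1) * tail N (real j)) + (\<Sum>j\<in>?B - ?A. (2 * real j + 1) * tail N (real j))"
      using card_nat_le_real(1)[OF \<open>x \<ge> 0\<close>] \<open>sqrt x \<le> x\<close>
      by (subst sum.subset_diff[of ?A ?B]) auto
    also have "(\<Sum>j\<in>?A. (2 * real j + 1) * tail N (real j)) \<le> real (card ?A) * K"
      by (rule sum_bounded_above) (rule small)
    also have "\<dots> \<le> (sqrt x + 1) * K"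
      by (intro mult_right_mono card_nat_le_real \<open>K \<ge> 0\<close> \<open>sqrt x \<ge> 0\<close>)
    also have "(\<Sum>j\<in>?B - ?A. (2 * real j + 1) * tail N (real j)) \<le> real (card (?B - ?A)) * T x"
      by (rule sum_bounded_above) (use large in auto)
    also have "real (card (?B - ?A)) \<le> real (card ?B)"
      using card_nat_le_real(1)[OF \<open>x \<ge> 0\<close>] by (intro of_nat_mono card_mono) auto
    also have "\<dots> \<le> x + 1"
      by (rule card_nat_le_real(2)[OF \<open>x \<ge> 0\<close>])
    finally show ?thesis
      using \<open>T x \<ge> 0\<close> by (simp add: mult_right_mono)
  qed
  \<comment> \<open>The denominator is x / (ln x)^(1 + \<epsilon>), which outgrows sqrt x. Only the
    second summand survives, and halving the logarithm leaves the factor 2^(1 + \<epsilon>).\<close>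
  have "((\<lambda>x. ((sqrt x + 1) * K + (x + 1) * T x) / (x\<^sup>2 * log_tail \<epsilon> x)) \<longlongrightarrow> 6 * c * 2 powr (1 + \<epsilon>)) at_top"
    unfolding T_def log_tail_def using eps c by (real_asymp simp: powr_divide field_simps)
  then have "eventually (\<lambda>x. ((sqrt x + 1) * K + (x + 1) * T x) / (x\<^sup>2 * log_tail \<epsilon> x) < 6 * c * 2 powr (1 + \<epsilon>) + 1) at_top"
    by (rule order_tendstoD) simp
  moreover have "eventually (\<lambda>x. sqrt x \<ge> X) at_top"
    by real_asymp
  ultimately have "eventually (\<lambda>x. truncated_moment x \<le> (6 * c * 2 powr (1 + \<epsilon>) + 1) * (x\<^sup>2 * log_tail \<epsilon> x)) at_top"
    using eventually_gt_at_top[of 1]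
  proof eventually_elim
    case (elim x)
    then have "x\<^sup>2 * log_tail \<epsilon> x > 0"
      by (simp add: log_tail_pos)
    with elim bound[of x] show ?case
      by (simp add: pos_divide_less_eq)
  qed
  then show thesis
    by (rule that)
qed

text \<open>The majorant for dominated convergence over the number of summands: linear in k, hence
  integrable when that number has finite mean, and valid from a threshold in x that is common to all
  k.\<close>

lemma sum_tail_dominated:
  assumes "\<delta> > 0"
  obtains C where "eventually (\<lambda>x. \<forall>k. real k * (\<integral>j. real j \<partial>N) \<le> (1 - \<delta>) * x \<longrightarrow>
    sum_tail k x / log_tail \<epsilon> x \<le> C * real k) at_top"
proof -
  obtain C where "eventually (\<lambda>x. truncated_moment x \<le> C * (x\<^sup>2 * log_tail \<epsilon> x)) at_top"
    by (rule eventually_truncated_moment_le)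
  then have "eventually (\<lambda>x. \<forall>k. real k * (\<integral>j. real j \<partial>N) \<le> (1 - \<delta>) * x \<longrightarrow>
    sum_tail k x / log_tail \<epsilon> x \<le> (2 * c + C / \<delta>\<^sup>2) * real k) at_top"
    using eventually_tail_le eventually_gt_at_top[of 1]
  proof eventually_elim
    case (elim x)
    have g: "log_tail \<epsilon> x > 0"
      using elim by (simp add: log_tail_pos)
    have "truncated_moment x / (\<delta> * x)\<^sup>2 \<le> C * (x\<^sup>2 * log_tail \<epsilon> x) / (\<delta> * x)\<^sup>2"
      using elim by (intro divide_right_mono) auto
    also have "\<dots> = C / \<delta>\<^sup>2 * log_tail \<epsilon> x"
      using elim by (simp add: power_mult_distrib)
    finally have "tail N x + truncated_moment x / (\<delta> * x)\<^sup>2 \<le> (2 * c + C / \<delta>\<^sup>2) * log_tail \<epsilon> x"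
      using elim by (simp add: algebra_simps)
    then have "real k * (tail N x + truncated_moment x / (\<delta> * x)\<^sup>2) \<le> real k * ((2 * c + C / \<delta>\<^sup>2) * log_tail \<epsilon> x)" for k
      by (intro mult_left_mono) auto
    then show ?case
      using sum_tail_le_uniform[OF mean _ assms, of x] elim g
      by (auto simp: pos_divide_le_eq mult_ac intro: order_trans)
  qed
  then show thesis
    by (rule that)
qed

text \<open>The principle of a single big jump: k chances for one summand to be large, while two
  large summands have negligible probability.\<close>

lemma sum_tail_fixed_asymptotics:
  "((\<lambda>x. sum_tail k x / log_tail \<epsilon> x) \<longlongrightarrow> c * real k) at_top"
proof (cases "k = 0")
  case True
  have "eventually (\<lambda>x. sum_tail k x / log_tail \<epsilon> x = 0) at_top"
    using eventually_gt_at_top[of 0] by eventually_elim (simp add: sum_tail_def True)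
  then show ?thesis
    using True by (simp add: tendsto_eventually)
next
  case False
  let ?l = "\<lambda>x. (1 - (1 - tail N x) ^ k) / log_tail \<epsilon> x"
  let ?u = "\<lambda>\<delta> x. (real k * tail N ((1 - \<delta>) * x) + (real k)\<^sup>2 * (tail N (\<delta> / real k * x))\<^sup>2) / log_tail \<epsilon> x"
  show ?thesis
  proof (rule tendsto_sandwich_family)
    fix \<delta> :: real
    assume \<delta>: "0 < \<delta>" "\<delta> < 1"
    show "eventually (\<lambda>x. ?l x \<le> sum_tail k x / log_tail \<epsilon> x \<and> sum_tail k x / log_tail \<epsilon> x \<le> ?u \<delta> x) at_top"
      using eventually_gt_at_top[of 1]
    proof eventually_elim
      case (elim x)
      then show ?case
        using log_tail_pos[of x \<epsilon>] sum_tail_ge[of x k] sum_tail_le_fixed[of x \<delta> k] \<delta>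
        by (simp add: divide_right_mono)
    qed
    show "(?l \<longlongrightarrow> c * real k) at_top"
    proof -
      \<comment> \<open>The one-sided filter requires the tail to stay strictly positive, which c >
        0 guarantees eventually.\<close>
      have "filterlim (tail N) (at_right 0) at_top"
        using tail_tendsto_0 eventually_tail_pos by (auto simp: filterlim_at elim: eventually_mono)
      then have "((\<lambda>x. (1 - (1 - tail N x) ^ k) / tail N x) \<longlongrightarrow> real k) at_top"
        by (rule filterlim_compose[OF tendsto_one_minus_power_ratio])
      from tendsto_mult[OF tail this]
      show ?thesis
        by (rule Lim_transform_eventually)
          (use eventually_tail_pos in \<open>eventually_elim, simp\<close>)
    qed
    have "((\<lambda>x. tail N ((1 - \<delta>) * x) / log_tail \<epsilon> x) \<longlongrightarrow> c / (1 - \<delta>)) at_top"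
      by (rule tendsto_ratio_scale[OF tail]) (use \<delta> in simp)
    moreover have "((\<lambda>x. tail N (\<delta> / real k * x) / log_tail \<epsilon> x) \<longlongrightarrow> c / (\<delta> / real k)) at_top"
      by (rule tendsto_ratio_scale[OF tail]) (use \<delta> False in simp)
    \<comment> \<open>In the squared tail one factor is absorbed by \<open>log_tail\<close>, and the
      other one tends to 0.\<close>
    moreover have "((\<lambda>x. tail N (\<delta> / real k * x)) \<longlongrightarrow> 0) at_top"
      by (rule filterlim_compose[OF tail_tendsto_0]) (use \<delta> False in real_asymp)
    ultimately have "((\<lambda>x. real k * (tail N ((1 - \<delta>) * x) / log_tail \<epsilon> x) +
        (real k)\<^sup>2 * (tail N (\<delta> / real k * x) / log_tail \<epsilon> x * tail N (\<delta> / real k * x)))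
        \<longlongrightarrow> real k * (c / (1 - \<delta>)) + (real k)\<^sup>2 * (c / (\<delta> / real k) * 0)) at_top"
      by (intro tendsto_add tendsto_mult tendsto_const)
    then show "(?u \<delta> \<longlongrightarrow> real k * (c / (1 - \<delta>))) at_top"
      by (simp add: add_divide_distrib power2_eq_square mult_ac)
  next
    show "((\<lambda>_. c * real k) \<longlongrightarrow> c * real k) (at_right 0)"
      by simp
    have "((\<lambda>\<delta>. real k * (c / (1 - \<delta>))) \<longlongrightarrow> real k * (c / (1 - 0))) (at_right 0)"
      by (intro tendsto_intros) auto
    then show "((\<lambda>\<delta>. real k * (c / (1 - \<delta>))) \<longlongrightarrow> c * real k) (at_right 0)"
      by (simp add: mult_ac)
  qed
qed

end
end

section \<open>The random sum: law, mean and tail\<close>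

lemma integral_indicator_tail:
  assumes "nat_law \<mu>"
  shows "integrable \<mu> (indicat_real {k. real k > y})" and "(\<integral>k. indicat_real {k. real k > y} k \<partial>\<mu>) = tail \<mu> y"
proof -
  interpret \<mu>: nat_law \<mu> by fact
  show "integrable \<mu> (indicat_real {k. real k > y})"
    by (simp add: \<mu>.sets_N \<mu>.emeasure_eq_measure)
  show "(\<integral>k. indicat_real {k. real k > y} k \<partial>\<mu>) = tail \<mu> y"
    by (simp add: tail_def)
qed

context nat_law
begin

context
  fixes \<mu> :: "nat measure"
  assumes \<mu>: "nat_law \<mu>"
begin

interpretation \<mu>: nat_law \<mu> by (rule \<mu>)

lemma measurable_random_sum_law:
  "(\<lambda>(k, d). \<Sum>i<k. d i) \<in> measurable (\<mu> \<Otimes>\<^sub>M P) (count_space (UNIV :: nat set))"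
proof -
  have "sets (\<mu> \<Otimes>\<^sub>M P) = sets (count_space UNIV \<Otimes>\<^sub>M (\<Pi>\<^sub>M i\<in>(UNIV :: nat set). count_space UNIV))"
    by (intro sets_pair_measure_cong sets_PiM_cong \<mu>.sets_N_cong sets_N_cong refl)
  then show ?thesis
    using measurable_random_sum measurable_cong_sets by blast
qed

lemma nat_law_random_sum: "nat_law (random_sum_law \<mu> N)"
proof -
  interpret pair: pair_prob_space \<mu> P ..
  show ?thesis
    unfolding nat_law_def nat_law_axioms_def random_sum_law_def
    by (auto intro!: pair.prob_space_distr measurable_random_sum_law)
qed

lemma tail_random_sum: "tail (random_sum_law \<mu> N) x = (\<integral>k. sum_tail k x \<partial>\<mu>)"
proof -
  let ?E = "(\<lambda>(k, d). \<Sum>i<k. d i) -` {j. real j > x} \<inter> space (\<mu> \<Otimes>\<^sub>M P)"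
  have E: "?E \<in> sets (\<mu> \<Otimes>\<^sub>M P)"
    using measurable_random_sum_law by (rule measurable_sets) simp
  have "tail (random_sum_law \<mu> N) x = measure (\<mu> \<Otimes>\<^sub>M P) ?E"
    unfolding tail_def random_sum_law_def by (rule measure_distr[OF measurable_random_sum_law]) simp
  also have "\<dots> = enn2real (\<integral>\<^sup>+k. emeasure P (Pair k -` ?E) \<partial>\<mu>)"
    unfolding measure_def by (subst P.P.emeasure_pair_measure_alt[OF E]) (rule refl)
  also have "(\<integral>\<^sup>+k. emeasure P (Pair k -` ?E) \<partial>\<mu>) = (\<integral>\<^sup>+k. ennreal (sum_tail k x) \<partial>\<mu>)"
    by (intro nn_integral_cong)
       (simp add: vimage_def space_pair_measure sum_tail_def P.P.emeasure_eq_measure)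
  also have "enn2real \<dots> = (\<integral>k. sum_tail k x \<partial>\<mu>)"
    by (rule integral_eq_nn_integral[symmetric]) (auto simp: sum_tail_nonneg)
  finally show ?thesis .
qed

text \<open>Wald's identity. In nonnegative integrals it needs no integrability, so finiteness of
  the mean of the random sum becomes a consequence.\<close>

lemma nn_integral_random_sum:
  "(\<integral>\<^sup>+j. ennreal (real j) \<partial>random_sum_law \<mu> N) = (\<integral>\<^sup>+k. ennreal (real k) \<partial>\<mu>) * (\<integral>\<^sup>+j. ennreal (real j) \<partial>N)"
proof -
  have "(\<integral>\<^sup>+j. ennreal (real j) \<partial>random_sum_law \<mu> N) =
      (\<integral>\<^sup>+p. ennreal (real (case p of (k, d) \<Rightarrow> \<Sum>i<k. d i)) \<partial>(\<mu> \<Otimes>\<^sub>M P))"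
    unfolding random_sum_law_def by (rule nn_integral_distr[OF measurable_random_sum_law]) simp
  also have "\<dots> = (\<integral>\<^sup>+k. \<integral>\<^sup>+d. ennreal (real (\<Sum>i<k. d i)) \<partial>P \<partial>\<mu>)"
    by (subst P.P.nn_integral_fst[symmetric])
       (use measurable_compose[OF measurable_random_sum_law, of "\<lambda>j. ennreal (real j)" borel] in simp_all)
  also have "(\<lambda>k. \<integral>\<^sup>+d. ennreal (real (\<Sum>i<k. d i)) \<partial>P) = (\<lambda>k. ennreal (real k) * (\<integral>\<^sup>+j. ennreal (real j) \<partial>N))"
  proof
    fix k
    have coord: "(\<integral>\<^sup>+d. ennreal (real (d i)) \<partial>P) = (\<integral>\<^sup>+j. ennreal (real j) \<partial>N)" for i
    proof -
      have "(\<integral>\<^sup>+j. ennreal (real j) \<partial>N) = (\<integral>\<^sup>+j. ennreal (real j) \<partial>distr P N (\<lambda>d. d i))"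
        by (simp add: distr_coordinate)
      also have "\<dots> = (\<integral>\<^sup>+d. ennreal (real (d i)) \<partial>P)"
        by (rule nn_integral_distr) (auto intro: measurable_component_singleton)
      finally show ?thesis ..
    qed
    have "(\<integral>\<^sup>+d. ennreal (real (\<Sum>i<k. d i)) \<partial>P) = (\<integral>\<^sup>+d. (\<Sum>i<k. ennreal (real (d i))) \<partial>P)"
      by simp
    also have "\<dots> = (\<Sum>i<k. \<integral>\<^sup>+d. ennreal (real (d i)) \<partial>P)"
      by (rule nn_integral_sum) measurable
    finally show "(\<integral>\<^sup>+d. ennreal (real (\<Sum>i<k. d i)) \<partial>P) = ennreal (real k) * (\<integral>\<^sup>+j. ennreal (real j) \<partial>N)"
      by (simp add: coord ennreal_of_nat_eq_real_of_nat)
  qed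
  finally show ?thesis
    by (simp add: nn_integral_multc)
qed

lemma mean_random_sum:
  assumes "integrable \<mu> real" and "integrable N real"
  shows "integrable (random_sum_law \<mu> N) real"
    and "(\<integral>j. real j \<partial>random_sum_law \<mu> N) = (\<integral>k. real k \<partial>\<mu>) * (\<integral>j. real j \<partial>N)"
proof -
  interpret R: nat_law "random_sum_law \<mu> N"
    by (rule nat_law_random_sum)
  have nn: "(\<integral>\<^sup>+j. ennreal (real j) \<partial>random_sum_law \<mu> N) = ennreal ((\<integral>k. real k \<partial>\<mu>) * (\<integral>j. real j \<partial>N))"
    unfolding nn_integral_random_sum using assms by (simp add: nn_integral_eq_integral ennreal_mult)
  then show "integrable (random_sum_law \<mu> N) real"
    by (intro integrableI_nonneg) auto
  show "(\<integral>j. real j \<partial>random_sum_law \<mu> N) = (\<integral>k. real k \<partial>\<mu>) * (\<integral>j. real j \<partial>N)"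
    by (subst integral_eq_nn_integral) (auto simp: nn)
qed

text \<open>For k up to (1 - \<delta>) x / m dominated convergence yields c times the mean of \<mu>.
  For k beyond (1 + \<delta>) x / m the sum exceeds x with probability near 1, which yields m / (1 +
  \<delta>). In the window between, the probability is bounded by 0 from below and by 1 from above,
  which replaces m / (1 + \<delta>) by m / (1 - \<delta>) in the upper bound.\<close>

lemma random_sum_tail_asymptotics:
  assumes eps: "\<epsilon> > 0" and c: "c > 0"
    and int_\<mu>: "integrable \<mu> real" and int_N: "integrable N real"
    and tail_\<mu>: "((\<lambda>x. tail \<mu> x / log_tail \<epsilon> x) \<longlongrightarrow> 1) at_top"
    and tail_N: "((\<lambda>x. tail N x / log_tail \<epsilon> x) \<longlongrightarrow> c) at_top"
    and m_pos: "(\<integral>j. real j \<partial>N) > 0"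
  shows "((\<lambda>x. tail (random_sum_law \<mu> N) x / log_tail \<epsilon> x) \<longlongrightarrow> c * (\<integral>k. real k \<partial>\<mu>) + (\<integral>j. real j \<partial>N)) at_top"
proof -
  define m where "m = (\<integral>j. real j \<partial>N)"
  define A where "A \<delta> x k = (if real k * m \<le> (1 - \<delta>) * x then sum_tail k x else 0)" for \<delta> x k
  have m: "m > 0"
    using m_pos by (simp add: m_def)
  have int_bounded: "integrable \<mu> h" if "\<And>k. \<bar>h k\<bar> \<le> 1" for h :: "nat \<Rightarrow> real"
    by (rule \<mu>.integrable_const_bound[where B = 1]) (use that in auto)
  have int_A: "integrable \<mu> (A \<delta> x)" and int_sum_tail: "integrable \<mu> (\<lambda>k. sum_tail k x)" for \<delta> x
    by (auto intro!: int_bounded simp: A_def sum_tail_nonneg sum_tail_le_1)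
  have bulk: "((\<lambda>x. (\<integral>k. A \<delta> x k \<partial>\<mu>) / log_tail \<epsilon> x) \<longlongrightarrow> c * (\<integral>k. real k \<partial>\<mu>)) at_top"
    if \<delta>: "0 < \<delta>" "\<delta> < 1" for \<delta>
  proof -
    obtain C where C: "eventually (\<lambda>x. \<forall>k. real k * m \<le> (1 - \<delta>) * x \<longrightarrow>
        sum_tail k x / log_tail \<epsilon> x \<le> C * real k) at_top"
      unfolding m_def by (rule sum_tail_dominated[OF eps c int_N tail_N \<delta>(1)])
    have "((\<lambda>x. \<integral>k. A \<delta> x k / log_tail \<epsilon> x \<partial>\<mu>) \<longlongrightarrow> (\<integral>k. c * real k \<partial>\<mu>)) at_top"
    proof (rule integral_dominated_convergence_at_top)
      show "integrable \<mu> (\<lambda>k. \<bar>C\<bar> * real k)"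
        using int_\<mu> by simp
      show "eventually (\<lambda>x. AE k in \<mu>. norm (A \<delta> x k / log_tail \<epsilon> x) \<le> \<bar>C\<bar> * real k) at_top"
        using C eventually_log_tail_pos[of \<epsilon>]
      proof eventually_elim
        case (elim x)
        have "norm (A \<delta> x k / log_tail \<epsilon> x) \<le> \<bar>C\<bar> * real k" for k
        proof (cases "real k * m \<le> (1 - \<delta>) * x")
          case True
          then have "sum_tail k x / log_tail \<epsilon> x \<le> C * real k"
            using elim by blast
          also have "\<dots> \<le> \<bar>C\<bar> * real k"
            by (intro mult_right_mono) auto
          finally show ?thesis
            using True elim by (simp add: A_def sum_tail_nonneg)
        qed (simp add: A_def)
        then show ?case
          by simp
      qed
      show "AE k in \<mu>. ((\<lambda>x. A \<delta> x k / log_tail \<epsilon> x) \<longlongrightarrow> c * real k) at_top"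
      proof (rule AE_I2)
        fix k
        \<comment> \<open>For fixed k the cut-off is inactive once x is large, so the pointwise
          limit is that of \<open>sum_tail\<close>.\<close>
        have "eventually (\<lambda>x. real k * m \<le> (1 - \<delta>) * x) at_top"
          using \<delta> by real_asymp
        then have "eventually (\<lambda>x. sum_tail k x / log_tail \<epsilon> x = A \<delta> x k / log_tail \<epsilon> x) at_top"
          by eventually_elim (simp add: A_def)
        with sum_tail_fixed_asymptotics[OF eps c int_N tail_N, of k]
        show "((\<lambda>x. A \<delta> x k / log_tail \<epsilon> x) \<longlongrightarrow> c * real k) at_top"
          by (rule Lim_transform_eventually)
      qed
    qed auto
    then show ?thesis
      by simp
  qed
  \<comment> \<open>The rate C / k becomes a rate in x, since k is at least x / m in this range; the
    absolute value covers a negative C. The constant depends on \<delta> and is made a function of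
    it below.\<close>
  have "\<exists>C. \<forall>x>0. \<forall>k. real k > (1 + \<delta>) / m * x \<longrightarrow> 1 - C / x \<le> sum_tail k x" if \<delta>: "0 < \<delta>" for \<delta>
  proof -
    have "m / (1 + \<delta>) < m"
      using m \<delta> by (simp add: field_simps)
    then obtain C where C: "\<And>k x. k > 0 \<Longrightarrow> x \<le> m / (1 + \<delta>) * real k \<Longrightarrow> 1 - C / real k \<le> sum_tail k x"
      using sum_tail_law_of_large_numbers[OF int_N, of "m / (1 + \<delta>)"] unfolding m_def by metis
    have "1 - \<bar>C\<bar> * m / x \<le> sum_tail k x" if "x > 0" "real k > (1 + \<delta>) / m * x" for k x
    proof -
      have "x / m \<le> (1 + \<delta>) / m * x"
        using m \<delta> that by (simp add: field_simps)
      then have k: "real k \<ge> x / m" "real k > 0"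
        using that m divide_pos_pos[of x m] by linarith+
      have "C / real k \<le> \<bar>C\<bar> / real k"
        by (intro divide_right_mono) auto
      also have "\<dots> \<le> \<bar>C\<bar> / (x / m)"
        using k m that by (intro divide_left_mono) auto
      finally have "C / real k \<le> \<bar>C\<bar> * m / x"
        by simp
      moreover have "1 - C / real k \<le> sum_tail k x"
        using k that m \<delta> by (intro C) (simp_all add: field_simps)
      ultimately show ?thesis
        by linarith
    qed
    then show ?thesis
      by (intro exI[of _ "\<bar>C\<bar> * m"]) auto
  qed
  then obtain C where lln: "\<And>\<delta> x k. 0 < \<delta> \<Longrightarrow> x > 0 \<Longrightarrow> real k > (1 + \<delta>) / m * x \<Longrightarrow> 1 - C \<delta> / x \<le> sum_tail k x"
    by metis
  let ?l = "\<lambda>\<delta> x. (\<integral>k. A \<delta> x k \<partial>\<mu>) / log_tail \<epsilon> x + (1 - C \<delta> / x) * (tail \<mu> ((1 + \<delta>) / m * x) / log_tail \<epsilon> x)"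
  let ?u = "\<lambda>\<delta> x. (\<integral>k. A \<delta> x k \<partial>\<mu>) / log_tail \<epsilon> x + tail \<mu> ((1 - \<delta>) / m * x) / log_tail \<epsilon> x"
  show ?thesis
    unfolding m_def[symmetric]
  proof (rule tendsto_sandwich_family)
    fix \<delta> :: real
    assume \<delta>: "0 < \<delta>" "\<delta> < 1"
    show "eventually (\<lambda>x. ?l \<delta> x \<le> tail (random_sum_law \<mu> N) x / log_tail \<epsilon> x \<and>
        tail (random_sum_law \<mu> N) x / log_tail \<epsilon> x \<le> ?u \<delta> x) at_top"
      using eventually_gt_at_top[of 1]
    proof eventually_elim
      case (elim x)
      let ?I = "\<lambda>y. indicat_real {k. real k > y}"
      note int_I = integral_indicator_tail[OF \<mu>]
      \<comment> \<open>By this strict inequality \<open>A\<close> and the indicator in the lower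
        bound never contribute for the same k.\<close>
      have "(1 - \<delta>) / m * x < (1 + \<delta>) / m * x"
        using \<delta> m elim by (intro mult_strict_right_mono divide_strict_right_mono) auto
      moreover have "real k * m \<le> (1 - \<delta>) * x \<longleftrightarrow> real k \<le> (1 - \<delta>) / m * x" for k
        using m by (simp add: field_simps)
      ultimately have lower: "A \<delta> x k + (1 - C \<delta> / x) * ?I ((1 + \<delta>) / m * x) k \<le> sum_tail k x" for k
        using lln[OF \<delta>(1), of x k] elim
        by (cases "real k > (1 + \<delta>) / m * x") (simp_all add: A_def sum_tail_nonneg)
      have upper: "sum_tail k x \<le> A \<delta> x k + ?I ((1 - \<delta>) / m * x) k" for k
        using m by (auto simp: A_def indicator_def sum_tail_le_1 field_simps)
      have "(\<integral>k. A \<delta> x k \<partial>\<mu>) + (1 - C \<delta> / x) * tail \<mu> ((1 + \<delta>) / m * x) =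
          (\<integral>k. A \<delta> x k + (1 - C \<delta> / x) * ?I ((1 + \<delta>) / m * x) k \<partial>\<mu>)"
        using int_A int_I by simp
      also have "\<dots> \<le> (\<integral>k. sum_tail k x \<partial>\<mu>)"
        by (intro integral_mono lower int_sum_tail Bochner_Integration.integrable_add
            integrable_mult_right int_A int_I)
      finally have 1: "(\<integral>k. A \<delta> x k \<partial>\<mu>) + (1 - C \<delta> / x) * tail \<mu> ((1 + \<delta>) / m * x) \<le> tail (random_sum_law \<mu> N) x"
        by (simp add: tail_random_sum)
      have "(\<integral>k. sum_tail k x \<partial>\<mu>) \<le> (\<integral>k. A \<delta> x k + ?I ((1 - \<delta>) / m * x) k \<partial>\<mu>)"
        by (intro integral_mono upper int_sum_tail Bochner_Integration.integrable_add int_A int_I)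
      also have "\<dots> = (\<integral>k. A \<delta> x k \<partial>\<mu>) + tail \<mu> ((1 - \<delta>) / m * x)"
        using int_A int_I by simp
      finally have 2: "tail (random_sum_law \<mu> N) x \<le> (\<integral>k. A \<delta> x k \<partial>\<mu>) + tail \<mu> ((1 - \<delta>) / m * x)"
        by (simp add: tail_random_sum)
      show ?case
        using divide_right_mono[OF 1, of "log_tail \<epsilon> x"] divide_right_mono[OF 2, of "log_tail \<epsilon> x"]
          log_tail_pos[OF elim, of \<epsilon>]
        by (simp add: add_divide_distrib)
    qed
    have scale: "((\<lambda>x. tail \<mu> (t / m * x) / log_tail \<epsilon> x) \<longlongrightarrow> m / t) at_top" if "t > 0" for t
      using tendsto_ratio_scale[OF tail_\<mu>, of "t / m"] m that by simp
    have "((\<lambda>x. 1 - C \<delta> / x) \<longlongrightarrow> 1) at_top"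
      by real_asymp
    then show "(?l \<delta> \<longlongrightarrow> c * (\<integral>k. real k \<partial>\<mu>) + 1 * (m / (1 + \<delta>))) at_top"
      using \<delta> by (intro tendsto_add tendsto_mult bulk scale) auto
    show "(?u \<delta> \<longlongrightarrow> c * (\<integral>k. real k \<partial>\<mu>) + m / (1 - \<delta>)) at_top"
      using \<delta> by (intro tendsto_add bulk scale) auto
  next
    have "((\<lambda>\<delta>. c * (\<integral>k. real k \<partial>\<mu>) + 1 * (m / (1 + \<delta>))) \<longlongrightarrow> c * (\<integral>k. real k \<partial>\<mu>) + 1 * (m / (1 + 0))) (at_right 0)"
      by (intro tendsto_intros) auto
    then show "((\<lambda>\<delta>. c * (\<integral>k. real k \<partial>\<mu>) + 1 * (m / (1 + \<delta>))) \<longlongrightarrow> c * (\<integral>k. real k \<partial>\<mu>) + m) (at_right 0)"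
      by simp
    have "((\<lambda>\<delta>. c * (\<integral>k. real k \<partial>\<mu>) + m / (1 - \<delta>)) \<longlongrightarrow> c * (\<integral>k. real k \<partial>\<mu>) + m / (1 - 0)) (at_right 0)"
      by (intro tendsto_intros) auto
    then show "((\<lambda>\<delta>. c * (\<integral>k. real k \<partial>\<mu>) + m / (1 - \<delta>)) \<longlongrightarrow> c * (\<integral>k. real k \<partial>\<mu>) + m) (at_right 0)"
      by simp
  qed
qed

end
end

section \<open>Induction on n and transfer to the random variable B\<close>

lemma D_law_tail_asymptotics:
  assumes "nat_law \<mu>" and eps: "\<epsilon> > 0"
    and int_\<mu>: "integrable \<mu> real"
    and b_def: "b = (\<integral>k. real k \<partial>\<mu>)" and b: "b > 0"
    and tail_\<mu>: "((\<lambda>x. tail \<mu> x / log_tail \<epsilon> x) \<longlongrightarrow> 1) at_top"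
  shows "nat_law (D_law \<mu> (Suc n)) \<and> integrable (D_law \<mu> (Suc n)) real \<and>
    (\<integral>k. real k \<partial>D_law \<mu> (Suc n)) = b ^ Suc n \<and>
    ((\<lambda>x. tail (D_law \<mu> (Suc n)) x / log_tail \<epsilon> x) \<longlongrightarrow> real (Suc n) * b ^ n) at_top"
proof (induction n)
  case 0
  then show ?case
    using assms by simp
next
  case (Suc n)
  interpret D: nat_law "D_law \<mu> (Suc n)"
    using Suc by blast
  note IH = Suc
  \<comment> \<open>Integrability and the mean belong to the induction hypothesis because the mean
    of the current law is the second term of the new coefficient.\<close>
  have "((\<lambda>x. tail (random_sum_law \<mu> (D_law \<mu> (Suc n))) x / log_tail \<epsilon> x) \<longlongrightarrow>
      real (Suc n) * b ^ n * (\<integral>k. real k \<partial>\<mu>) + (\<integral>k. real k \<partial>D_law \<mu> (Suc n))) at_top"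
    by (rule D.random_sum_tail_asymptotics[OF assms(1) eps _ int_\<mu> _ tail_\<mu>]) (use IH b in auto)
  \<comment> \<open>The mean of the summand is \<open>b ^ Suc n\<close>, so each step multiplies the
    old coefficient by b and adds one more copy of that power.\<close>
  also have "real (Suc n) * b ^ n * (\<integral>k. real k \<partial>\<mu>) + (\<integral>k. real k \<partial>D_law \<mu> (Suc n)) = real (Suc (Suc n)) * b ^ Suc n"
    using IH by (simp add: b_def[symmetric] algebra_simps)
  finally show ?case
    using IH D.nat_law_random_sum[OF assms(1)] D.mean_random_sum[OF assms(1) int_\<mu>] by (simp add: b_def)
qed

theorem lemma3p2:
  fixes M :: "'a measure" and B :: "'a \<Rightarrow> nat" and L :: "real \<Rightarrow> real"
    and b \<epsilon> :: real and n :: nat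
  assumes "prob_space M"
    and "B \<in> measurable M (count_space UNIV)"
    and "integrable M (\<lambda>\<omega>. real (B \<omega>))"
    and "b = (\<integral>\<omega>. real (B \<omega>) \<partial>M)"
    and "0 < b" and "b < 1"
    and "slowly_varying L"
    and "\<And>x. x > 0 \<Longrightarrow> \<P>(\<omega> in M. real (B \<omega>) > x) = L x / (1 + x)"
    and "\<epsilon> > 0"
    and "L \<sim>[at_top] (\<lambda>x. ln x powr (- 1 - \<epsilon>))"
    and "n \<ge> 1"
  shows "(\<lambda>x::real. \<P>(k in D_law (distr M (count_space UNIV) B) n. real k > x))
           \<sim>[at_top] (\<lambda>x. real n * b ^ (n - 1) * \<P>(\<omega> in M. real (B \<omega>) > x))"
proof -
  let ?\<mu> = "distr M (count_space UNIV) B"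
  interpret M: prob_space M by fact
  interpret \<mu>: nat_law ?\<mu>
    using M.prob_space_distr[OF assms(2)] by (simp add: nat_law_def nat_law_axioms_def)
  have tail_\<mu>_eq: "tail ?\<mu> x = \<P>(\<omega> in M. real (B \<omega>) > x)" for x
    unfolding tail_def by (subst measure_distr[OF assms(2)]) (auto intro!: arg_cong[where f = M.prob])
  \<comment> \<open>Asymptotic equivalence counts 0 / 0 as 1; excluding that case gives a limit of
    the plain quotient.\<close>
  have "eventually (\<lambda>x. L x \<noteq> 0 \<or> ln x powr (- 1 - \<epsilon>) \<noteq> 0) at_top"
    using eventually_gt_at_top[of 1] by eventually_elim simp
  then have "((\<lambda>x. L x / ln x powr (- 1 - \<epsilon>)) \<longlongrightarrow> 1) at_top"
    by (rule asymp_equivD_strong[OF assms(10)])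
  \<comment> \<open>This factor trades the denominator 1 + x of the hypothesis for the x in
    \<open>log_tail\<close>.\<close>
  moreover have "((\<lambda>x::real. x / (1 + x)) \<longlongrightarrow> 1) at_top"
    by real_asymp
  ultimately have "((\<lambda>x. L x / ln x powr (- 1 - \<epsilon>) * (x / (1 + x))) \<longlongrightarrow> 1 * 1) at_top"
    by (rule tendsto_mult)
  moreover have "eventually (\<lambda>x. L x / ln x powr (- 1 - \<epsilon>) * (x / (1 + x)) = tail ?\<mu> x / log_tail \<epsilon> x) at_top"
    using eventually_gt_at_top[of 1]
  proof eventually_elim
    case (elim x)
    have "ln x powr (- 1 - \<epsilon>) = 1 / ln x powr (1 + \<epsilon>)"
      using powr_minus_divide[of "ln x" "1 + \<epsilon>"] by simp
    then show ?case
      using elim assms(8)[of x] by (simp add: tail_\<mu>_eq log_tail_def)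
  qed
  ultimately have tail_\<mu>: "((\<lambda>x. tail ?\<mu> x / log_tail \<epsilon> x) \<longlongrightarrow> 1) at_top"
    by (auto intro: Lim_transform_eventually)
  obtain l where n: "n = Suc l"
    using \<open>n \<ge> 1\<close> by (cases n) auto
  have int_\<mu>: "integrable ?\<mu> real" and mean: "b = (\<integral>k. real k \<partial>?\<mu>)"
    by (subst integrable_distr_eq[OF assms(2)]; simp add: assms(3))
      (subst integral_distr[OF assms(2)]; simp add: assms(4))
  have D: "nat_law (D_law ?\<mu> n)"
    and tail_D: "((\<lambda>x. tail (D_law ?\<mu> n) x / log_tail \<epsilon> x) \<longlongrightarrow> real n * b ^ (n - 1)) at_top"
    using D_law_tail_asymptotics[OF \<mu>.nat_law_axioms \<open>\<epsilon> > 0\<close> int_\<mu> mean \<open>0 < b\<close> tail_\<mu>, of l]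
    by (simp_all add: n)
  interpret D: nat_law "D_law ?\<mu> n" by (rule D)
  \<comment> \<open>Both tails have been compared with \<open>log_tail\<close>, which cancels in the
    quotient.\<close>
  have "((\<lambda>x. (tail (D_law ?\<mu> n) x / log_tail \<epsilon> x) / (tail ?\<mu> x / log_tail \<epsilon> x)) \<longlongrightarrow>
      real n * b ^ (n - 1) / 1) at_top"
    by (rule tendsto_divide[OF tail_D tail_\<mu>]) simp
  moreover have "eventually (\<lambda>x. (tail (D_law ?\<mu> n) x / log_tail \<epsilon> x) / (tail ?\<mu> x / log_tail \<epsilon> x) =
      tail (D_law ?\<mu> n) x / tail ?\<mu> x) at_top"
    using eventually_log_tail_pos[of \<epsilon>] by eventually_elim simp
  ultimately have "((\<lambda>x. tail (D_law ?\<mu> n) x / tail ?\<mu> x) \<longlongrightarrow> real n * b ^ (n - 1)) at_top"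
    by (auto intro: Lim_transform_eventually)
  then have "(\<lambda>x. tail (D_law ?\<mu> n) x) \<sim>[at_top] (\<lambda>x. real n * b ^ (n - 1) * tail ?\<mu> x)"
    by (rule asymp_equivI'_const) (use \<open>n \<ge> 1\<close> \<open>0 < b\<close> in simp)
  then show ?thesis
    by (simp only: tail_\<mu>_eq) (simp add: tail_def)
qed

end
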